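(* Suppose the provider routes to model 2 (i.e. $i=2$). Then the user best response is $q^*(2,s)=\mathbf 1\{\xi_2<0\}$ for every $s\in[0,1]$; that is, $q=1$ maximizes $q\mapsto U_2(q)$ over $[0,1]$ if $\xi_2<0$, and $q=0$ maximizes it over $[0,1]$ if $\xi_2\ge 0$.
   Context: Two models $M_1,M_2$ have success probabilities $0<p_1<p_2<1$, user latencies $t_1<t_2$ in $[0,1]$, and provider costs $c_1<c_2$ in $[0,1]$. A success is worth $V>0$ to the user, and $\xi_i:=Vp_i-t_i$ for $i\in\{1,2\}$. A provider policy is a pair $(i,s)$ with $i\in\{1,2\}$ the initial model and $s\in[0,1]$ the probability of cascading from $M_1$ to $M_2$ after a failure of $M_1$ (irrelevant if $i=2$). The user chooses an abandonment probability $q\in[0,1]$, the probability of leaving after a failed attempt. Let $\beta(q):=\frac{1}{p_2+(1-p_2)q}$. When $i=2$, the success probability is $S_2(q)=\beta(q)p_2$, the expected total latency is $L_2(q)=\beta(q)t_2$, and the user's expected utility is $U_2(q):=V S_2(q)-L_2(q)$. The user best response $q^*(2,s)$ is a maximizer of $U_2(q)$ over $q\in[0,1]$. *)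

theory Defs
  imports Complex_Main
begin

definition xi :: "real \<Rightarrow> real \<Rightarrow> real \<Rightarrow> real" where
  "xi V p t = V * p - t"

text \<open>A process initially routed to model 2 stays on model 2. An attempt fails and is
  followed by another one with probability \<open>(1 - p2) * (1 - q)\<close>, so the expected number of
  attempts is \<open>1 / (1 - (1 - p2) * (1 - q)) = 1 / (p2 + (1 - p2) * q)\<close>.\<close>

definition beta2 :: "real \<Rightarrow> real \<Rightarrow> real" where
  "beta2 p2 q = 1 / (p2 + (1 - p2) * q)"

definition S2 :: "real \<Rightarrow> real \<Rightarrow> real" where
  "S2 p2 q = beta2 p2 q * p2"

definition L2 :: "real \<Rightarrow> real \<Rightarrow> real \<Rightarrow> real" where
  "L2 p2 t2 q = beta2 p2 q * t2"

definition U2 :: "real \<Rightarrow> real \<Rightarrow> real \<Rightarrow> real \<Rightarrow> real" where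
  "U2 V p2 t2 q = V * S2 p2 q - L2 p2 t2 q"

text \<open>\<open>q\<close> is a best response of the user to the provider policy \<open>(2, s)\<close>. The cascading
  probability \<open>s\<close> only matters after a failure of model 1, so the objective does not depend
  on it. This is a predicate rather than a function because the maximizer need not be
  unique: the objective is constant if \<open>xi V p2 t2 = 0\<close>.\<close>

definition best_response2 :: "real \<Rightarrow> real \<Rightarrow> real \<Rightarrow> real \<Rightarrow> real \<Rightarrow> bool" where
  "best_response2 V p2 t2 s q \<longleftrightarrow> is_arg_max (U2 V p2 t2) (\<lambda>q. q \<in> {0..1}) q"

end

(* The utility factors as U2(q) = xi_2 * beta(q) with beta decreasing in q, so the sign of xi_2
   decides which endpoint of [0,1] is optimal. *)

theory Submission
  imports Defs
begin

text \<open>Expected success and latency are both proportional to the expected number of attempts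
  \<open>beta2\<close>, each attempt having net worth \<open>xi\<close> (\<open>U2_eq\<close>). A
  larger \<open>q\<close> means fewer attempts (\<open>beta2_antimono\<close>), so negative worth
  calls for leaving at once and nonnegative worth for never leaving.\<close>

lemma U2_eq: "U2 V p t q = xi V p t * beta2 p q"
  by (simp add: U2_def S2_def L2_def xi_def algebra_simps)

lemma beta2_antimono:
  assumes "0 < p" "p \<le> 1" "0 \<le> q" "q \<le> q'"
  shows "beta2 p q' \<le> beta2 p q"
proof -
  \<comment> \<open>Both denominators are thus at least \<open>p\<close>, hence positive, and
    ordered like \<open>q\<close> and \<open>q'\<close>.\<close>
  have "(1 - p) * q \<le> (1 - p) * q'" "0 \<le> (1 - p) * q"
    using assms by (simp_all add: mult_left_mono)
  then show ?thesis
    unfolding beta2_def using assms(1) by (intro divide_left_mono mult_pos_pos) linarith+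
qed

text \<open>A nonpositive factor \<open>xi\<close> reverses the monotonicity of
  \<open>beta2\<close>, so the utility is nondecreasing in \<open>q\<close>.\<close>

lemma is_arg_max_U2_one:
  assumes "0 < p" "p \<le> 1" "xi V p t \<le> 0"
  shows "is_arg_max (U2 V p t) (\<lambda>q. q \<in> {0..1}) 1"
  using assms
  by (auto simp: is_arg_max_linorder U2_eq intro!: mult_left_mono_neg beta2_antimono)

lemma is_arg_max_U2_zero:
  assumes "0 < p" "p \<le> 1" "0 \<le> xi V p t"
  shows "is_arg_max (U2 V p t) (\<lambda>q. q \<in> {0..1}) 0"
  using assms
  by (auto simp: is_arg_max_linorder U2_eq intro!: mult_left_mono beta2_antimono)

theorem theorem1:
  fixes V p1 p2 t1 t2 c1 c2 :: real
  assumes "0 < p1" and "p1 < p2" and "p2 < 1"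
    and "t1 \<in> {0..1}" and "t2 \<in> {0..1}" and "t1 < t2"
    and "c1 \<in> {0..1}" and "c2 \<in> {0..1}" and "c1 < c2"
    and "V > 0"
  shows "(\<forall>s\<in>{0..1}. best_response2 V p2 t2 s (of_bool (xi V p2 t2 < 0))) \<and>
    (xi V p2 t2 < 0 \<longrightarrow> is_arg_max (U2 V p2 t2) (\<lambda>q. q \<in> {0..1}) 1) \<and>
    (xi V p2 t2 \<ge> 0 \<longrightarrow> is_arg_max (U2 V p2 t2) (\<lambda>q. q \<in> {0..1}) 0)"
proof -
  have p2: "0 < p2" "p2 \<le> 1"
    using assms by auto
  show ?thesis
    using is_arg_max_U2_one[OF p2, of V t2] is_arg_max_U2_zero[OF p2, of V t2]
    by (auto simp: best_response2_def of_bool_def)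
qed

end
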